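(* For every ecumenical formula of the form $A^c$ (with $A^i$ its intuitionistic counterpart), both $A^c\Vdash\neg\neg A^i$ and $\neg\neg A^i\Vdash A^c$ hold.
   Context: Basic setting. Let $\mathsf{At}$ be a countably infinite set of atomic propositions and $\mathsf{At}_\bot=\mathsf{At}\cup\{\bot\}$. An atomic rule has the form "from premises $p_1,\dots,p_n$ ($n\ge 0$) infer $p$", with $p_j,p\in\mathsf{At}_\bot$, where the derivation of each premise may discharge a set of basic sentences. An atomic system $S$ is a set of atomic rules; $S\subseteq S'$ ($S'$ extends $S$) if $S'$ contains all rules of $S$. $\Delta\vdash_S p$ means there is a natural-deduction derivation using only rules of $S$ with conclusion $p$ and undischarged assumptions in $\Delta$ (so $p\vdash_S p$). $S$ is consistent if $\nvdash_S\bot$. Standing convention: all atomic systems (including all extensions quantified over) are required to be consistent. Ecumenical formulas: $p^i,p^c$ for $p\in\mathsf{At}_\bot$; $(A\wedge B)^x,(A\vee B)^x,(A\to B)^x$ for $x\in\{i,c\}$. $A\wedge B$, $A\vee B$, $A\to B$ abbreviate the $i$-versions, $\bot$ denotes $\bot^i$, $\neg A:=(A\to\bot^i)^i$; for a formula $X^c$ (atomic or not), $X^i$ is the same construction with outer superscript $i$. Weak validity (by simultaneous recursion): (1) $\Vdash^L_S p^i$ iff $\vdash_S p$ ($p\in\mathsf{At}_\bot$); (2) $\Vdash^L_S p^c$ iff $p\nvdash_S\bot$; (3) for non-atomic $X$, $\Vdash^L_S X^c$ iff $X^i\nVdash^L_S\bot$; (4) $\Vdash^L_S(A\wedge B)^i$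 iff $\Vdash^L_S A$ and $\Vdash^L_S B$; (5) $\Vdash^L_S(A\to B)^i$ iff $A\Vdash^G_S B$; (6) $\Vdash^L_S(A\vee B)^i$ iff for all $S'\supseteq S$ and all $p\in\mathsf{At}_\bot$, if $A\Vdash^L_{S'}p^i$ and $B\Vdash^L_{S'}p^i$ then $\Vdash^L_{S'}p^i$; (7) for nonempty $\Gamma$, $\Gamma\Vdash^L_S A$ iff for all $S'\supseteq S$, if $\Vdash^L_{S'}B$ for all $B\in\Gamma$ then $\Vdash^L_{S'}A$; (8) $\Gamma\Vdash^G_S A$ iff for all $S'\supseteq S$: if $\Vdash^L_{S''}B$ for all $B\in\Gamma$ and all $S''\supseteq S'$, then $\Vdash^L_{S''}A$ for all $S''\supseteq S'$; (9) $\Gamma\Vdash A$ iff $\Gamma\Vdash^G_S A$ for all atomic systems $S$. *)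

theory Defs
  imports Main "HOL-Library.Countable" "HOL-Library.Infinite_Typeclass"
begin

datatype 'a basic = At 'a | Falsum

text \<open>In a rule, each premise is paired with the set of basic sentences that its derivation
  may discharge. \<open>Falsum\<close> gets no special treatment: ex falso is not built into derivability.\<close>

datatype 'a rule = Rule "('a basic set \<times> 'a basic) list" "'a basic"

type_synonym 'a system = "'a rule set"

text \<open>\<open>derives S \<Delta> p\<close>: some natural-deduction derivation of \<open>p\<close> by rules of \<open>S\<close> has all its
  undischarged assumptions in \<open>\<Delta>\<close>.\<close>

inductive derives :: "'a system \<Rightarrow> 'a basic set \<Rightarrow> 'a basic \<Rightarrow> bool" for S where
  assumption: "p \<in> \<Delta> \<Longrightarrow> derives S \<Delta> p"
| rule: "Rule ps p \<in> S \<Longrightarrow> (\<And>\<Gamma> q. (\<Gamma>, q) \<in> set ps \<Longrightarrow> derives S (\<Delta> \<union> \<Gamma>) q) \<Longrightarrow> derives S \<Delta> p"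

definition consistent :: "'a system \<Rightarrow> bool" where
  "consistent S \<longleftrightarrow> \<not> derives S {} Falsum"

text \<open>All atomic systems are required to be consistent, in particular all extensions quantified over.\<close>

definition extends :: "'a system \<Rightarrow> 'a system \<Rightarrow> bool" (infix "\<sqsupseteq>" 50) where
  "S' \<sqsupseteq> S \<longleftrightarrow> consistent S' \<and> S \<subseteq> S'"

text \<open>A formula is a \<open>shape\<close> (a basic sentence, or a connective applied to formulas) carrying an
  outer superscript: \<open>Intu X\<close> is $X^i$ and \<open>Clas X\<close> is $X^c$.\<close>

datatype 'a formula = Intu "'a shape" | Clas "'a shape"
  and 'a shape =
    is_Basic: Basic "'a basic"
  | Conj "'a formula" "'a formula"
  | Disj "'a formula" "'a formula"
  | Imp "'a formula" "'a formula"

abbreviation bot_i :: "'a formula" where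
  "bot_i \<equiv> Intu (Basic Falsum)"

definition Neg :: "'a formula \<Rightarrow> 'a formula" where
  "Neg A = Intu (Imp A bot_i)"

text \<open>Weak validity \<open>holds S A\<close> of a formula (without premises) in \<open>S\<close>. The local and global
  consequence relations occurring in the clauses are unfolded here; \<open>holds_clauses\<close> below
  restates the clauses in terms of these relations.\<close>

function holds :: "'a system \<Rightarrow> 'a formula \<Rightarrow> bool" where
  "holds S (Intu (Basic p)) \<longleftrightarrow> derives S {} p"
| "holds S (Clas (Basic p)) \<longleftrightarrow> \<not> derives S {p} Falsum"
| "\<not> is_Basic X \<Longrightarrow> holds S (Clas X) \<longleftrightarrow>
     \<not> (\<forall>S'. S' \<sqsupseteq> S \<longrightarrow> holds S' (Intu X) \<longrightarrow> holds S' bot_i)"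
| "holds S (Intu (Conj A B)) \<longleftrightarrow> holds S A \<and> holds S B"
| "holds S (Intu (Imp A B)) \<longleftrightarrow>
     (\<forall>S'. S' \<sqsupseteq> S \<longrightarrow> (\<forall>S''. S'' \<sqsupseteq> S' \<longrightarrow> holds S'' A) \<longrightarrow> (\<forall>S''. S'' \<sqsupseteq> S' \<longrightarrow> holds S'' B))"
| "holds S (Intu (Disj A B)) \<longleftrightarrow>
     (\<forall>S'. S' \<sqsupseteq> S \<longrightarrow> (\<forall>p.
        (\<forall>S''. S'' \<sqsupseteq> S' \<longrightarrow> holds S'' A \<longrightarrow> holds S'' (Intu (Basic p))) \<longrightarrow>
        (\<forall>S''. S'' \<sqsupseteq> S' \<longrightarrow> holds S'' B \<longrightarrow> holds S'' (Intu (Basic p))) \<longrightarrow>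
        holds S' (Intu (Basic p))))"
  by (auto, metis formula.exhaust is_Basic_def shape.exhaust)

lemma size_basic: "size (p :: 'a basic) = Suc 0"
  by (cases p) auto

lemma size_formula: "Suc 0 < size (A :: 'a formula)"
proof -
  have "0 < size X" for X :: "'a shape" by (cases X) (auto simp: size_basic)
  then show ?thesis by (cases A) auto
qed

termination holds
proof (relation "measures [\<lambda>(S, A). size A, \<lambda>(S, A). case A of Intu X \<Rightarrow> 0 | Clas X \<Rightarrow> 1]")
  fix X :: "'a shape" and S S' :: "'a system"
  assume "\<not> is_Basic X"
  then show "((S', bot_i), (S, Clas X)) \<in>
      measures [\<lambda>(S, A). size A, \<lambda>(S, A). case A of Intu X \<Rightarrow> 0 | Clas X \<Rightarrow> 1]"
    by (cases X) (auto simp: size_formula trans_less_add1)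
qed (auto simp: size_basic size_formula trans_less_add1)

definition local_conseq :: "'a formula set \<Rightarrow> 'a system \<Rightarrow> 'a formula \<Rightarrow> bool" where
  "local_conseq \<Gamma> S A \<longleftrightarrow>
     (if \<Gamma> = {} then holds S A
      else \<forall>S'. S' \<sqsupseteq> S \<longrightarrow> (\<forall>B\<in>\<Gamma>. holds S' B) \<longrightarrow> holds S' A)"

definition global_conseq :: "'a formula set \<Rightarrow> 'a system \<Rightarrow> 'a formula \<Rightarrow> bool" where
  "global_conseq \<Gamma> S A \<longleftrightarrow>
     (\<forall>S'. S' \<sqsupseteq> S \<longrightarrow>
        (\<forall>B\<in>\<Gamma>. \<forall>S''. S'' \<sqsupseteq> S' \<longrightarrow> holds S'' B) \<longrightarrow>
        (\<forall>S''. S'' \<sqsupseteq> S' \<longrightarrow> holds S'' A))"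

definition conseq :: "'a formula set \<Rightarrow> 'a formula \<Rightarrow> bool" (infix "\<tturnstile>" 50) where
  "\<Gamma> \<tturnstile> A \<longleftrightarrow> (\<forall>S. consistent S \<longrightarrow> global_conseq \<Gamma> S A)"

lemma holds_clauses:
  "holds S A \<longleftrightarrow> local_conseq {} S A"
  "local_conseq {} S (Intu (Basic p)) \<longleftrightarrow> derives S {} p"
  "local_conseq {} S (Clas (Basic p)) \<longleftrightarrow> \<not> derives S {p} Falsum"
  "\<not> is_Basic X \<Longrightarrow> local_conseq {} S (Clas X) \<longleftrightarrow> \<not> local_conseq {Intu X} S bot_i"
  "local_conseq {} S (Intu (Conj A B)) \<longleftrightarrow> local_conseq {} S A \<and> local_conseq {} S B"
  "local_conseq {} S (Intu (Imp A B)) \<longleftrightarrow> global_conseq {A} S B"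
  "local_conseq {} S (Intu (Disj A B)) \<longleftrightarrow>
     (\<forall>S'. S' \<sqsupseteq> S \<longrightarrow> (\<forall>p.
        local_conseq {A} S' (Intu (Basic p)) \<longrightarrow> local_conseq {B} S' (Intu (Basic p)) \<longrightarrow>
        local_conseq {} S' (Intu (Basic p))))"
  by (simp_all add: local_conseq_def global_conseq_def)

end

theory Submission
  imports Defs
begin

text \<open>For every shape \<open>X\<close>, basic or not, $X^c$ holds in \<open>S\<close> iff $X^i$ holds in some consistent
  extension of \<open>S\<close>; for a basic sentence the extension is obtained by adding it as an axiom.
  Likewise $\neg\neg X^i$ holds in \<open>S\<close> iff every consistent extension of \<open>S\<close> has a further one
  throughout whose extensions $X^i$ holds. Validity need not be preserved under extension, so the
  step from the first condition to the second is made at maximal consistent systems: derivations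
  use finitely many rules, so these exist by Zorn's lemma, and such a system is its own only
  extension, so local and global validity coincide in it.\<close>

lemma derives_mono: "derives S \<Delta> p \<Longrightarrow> S \<subseteq> S' \<Longrightarrow> \<Delta> \<subseteq> \<Delta>' \<Longrightarrow> derives S' \<Delta>' p"
proof (induction arbitrary: \<Delta>' rule: derives.induct)
  case (assumption p \<Delta>)
  then show ?case by (blast intro: derives.assumption)
next
  case (rule ps p \<Delta>)
  show ?case
  proof (rule derives.rule)
    show "Rule ps p \<in> S'" using rule by blast
    show "derives S' (\<Delta>' \<union> \<Gamma>) q" if "(\<Gamma>, q) \<in> set ps" for \<Gamma> q
      using rule.IH[OF that] rule.prems by (meson Un_mono order_refl)
  qed
qed

text \<open>Derivations are grafted onto the assumption leaves. \<open>\<Delta>'\<close> is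
  generalised because a rule adds its discharged sets to both contexts.\<close>

lemma derives_cut:
  "derives S \<Delta> q \<Longrightarrow> (\<And>r. r \<in> \<Delta> \<Longrightarrow> derives S \<Delta>' r) \<Longrightarrow> derives S \<Delta>' q"
proof (induction arbitrary: \<Delta>' rule: derives.induct)
  case (rule ps p \<Delta>)
  show ?case
  proof (rule derives.rule[OF rule.hyps(1)])
    fix \<Gamma> q
    assume "(\<Gamma>, q) \<in> set ps"
    then show "derives S (\<Delta>' \<union> \<Gamma>) q"
    proof (rule rule.IH)
      show "derives S (\<Delta>' \<union> \<Gamma>) r" if "r \<in> \<Delta> \<union> \<Gamma>" for r
        using that rule.prems[of r] derives_mono[of S \<Delta>' r S "\<Delta>' \<union> \<Gamma>"]
        by (auto intro: derives.assumption)
    qed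
  qed
qed auto

text \<open>Each use of the axiom becomes an appeal to the assumption \<open>p\<close>, which stays
  available since contexts only grow towards the leaves.\<close>

lemma derives_insert_axiom:
  "derives (insert (Rule [] p) S) \<Delta> q \<Longrightarrow> derives S (insert p \<Delta>) q"
proof (induction rule: derives.induct)
  case (assumption q \<Delta>)
  then show ?case by (blast intro: derives.assumption)
next
  case (rule ps q \<Delta>)
  show ?case
  proof (cases "Rule ps q = Rule [] p")
    case True
    then show ?thesis by (auto intro: derives.assumption)
  next
    case False
    with rule show ?thesis by (auto intro!: derives.rule[of ps q S])
  qed
qed

text \<open>Premises form a finite list, so a derivation is a finite tree: at each node, the current
  rule joins the finite sets collected for the premises.\<close>

lemma derives_compact: "derives S \<Delta> p \<Longrightarrow> \<exists>F. finite F \<and> F \<subseteq> S \<and> derives F \<Delta> p"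
proof (induction rule: derives.induct)
  case (assumption p \<Delta>)
  then show ?case by (blast intro: derives.assumption)
next
  case (rule ps p \<Delta>)
  then have "\<exists>F. finite F \<and> F \<subseteq> S \<and> derives F (\<Delta> \<union> fst x) (snd x)" if "x \<in> set ps" for x
    using that by (metis prod.collapse)
  then obtain F where F: "\<And>x. x \<in> set ps \<Longrightarrow>
      finite (F x) \<and> F x \<subseteq> S \<and> derives (F x) (\<Delta> \<union> fst x) (snd x)"
    by metis
  let ?G = "insert (Rule ps p) (\<Union>x\<in>set ps. F x)"
  have "derives ?G (\<Delta> \<union> \<Gamma>) q" if "(\<Gamma>, q) \<in> set ps" for \<Gamma> q
  proof (rule derives_mono)
    show "derives (F (\<Gamma>, q)) (\<Delta> \<union> \<Gamma>) q" using F[OF that] by simp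
  qed (use that in auto)
  then have "derives ?G \<Delta> p" by (blast intro: derives.rule)
  moreover have "finite ?G" "?G \<subseteq> S" using F rule.hyps(1) by auto
  ultimately show ?case by blast
qed

text \<open>The finitely many rules deriving \<open>Falsum\<close> from the union would already lie
  in one member of the chain.\<close>

lemma consistent_Union_chain:
  assumes "subset.chain {S. consistent S} C" and "C \<noteq> {}"
  shows "consistent (\<Union>C)"
  unfolding consistent_def
proof
  assume "derives (\<Union>C) {} Falsum"
  then obtain F where F: "finite F" "F \<subseteq> \<Union>C" "derives F {} Falsum"
    by (blast dest: derives_compact)
  obtain S where "S \<in> C" "F \<subseteq> S"
    using finite_subset_Union_chain[OF F(1,2) assms(2,1)] by blast
  then have "derives S {} Falsum" by (intro derives_mono[OF F(3)]) auto
  then show False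
    using assms(1) \<open>S \<in> C\<close> by (auto simp: subset_chain_def consistent_def)
qed

lemma extends_refl: "consistent S \<Longrightarrow> S \<sqsupseteq> S"
  by (simp add: extends_def)

lemma extends_trans: "S'' \<sqsupseteq> S' \<Longrightarrow> S' \<sqsupseteq> S \<Longrightarrow> S'' \<sqsupseteq> S"
  by (auto simp: extends_def)

lemma maximal_extension_exists:
  assumes "consistent S"
  obtains M where "M \<sqsupseteq> S" and "\<And>S'. S' \<sqsupseteq> M \<Longrightarrow> S' = M"
proof -
  have "\<exists>M\<in>{S'. S' \<sqsupseteq> S}. \<forall>X\<in>{S'. S' \<sqsupseteq> S}. M \<subseteq> X \<longrightarrow> X = M"
  proof (rule subset_Zorn_nonempty)
    show "{S'. S' \<sqsupseteq> S} \<noteq> {}" using extends_refl[OF assms] by blast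
    fix C
    assume C: "C \<noteq> {}" "subset.chain {S'. S' \<sqsupseteq> S} C"
    then have "subset.chain {S. consistent S} C"
      by (auto simp: subset_chain_def extends_def)
    then have "consistent (\<Union>C)" using C(1) by (rule consistent_Union_chain)
    moreover have "S \<subseteq> \<Union>C" using C unfolding subset_chain_def extends_def by blast
    ultimately show "\<Union>C \<in> {S'. S' \<sqsupseteq> S}" by (simp add: extends_def)
  qed
  then obtain M where M: "M \<sqsupseteq> S" "\<And>S'. S' \<sqsupseteq> S \<Longrightarrow> M \<subseteq> S' \<Longrightarrow> S' = M"
    by blast
  \<comment> \<open>Zorn gives maximality among the extensions of \<open>S\<close>; every extension
    of \<open>M\<close> is one of these.\<close>
  have "S' = M" if "S' \<sqsupseteq> M" for S'
    using that M(2) extends_trans[OF that M(1)] by (simp add: extends_def)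
  with M(1) show thesis by (rule that)
qed

text \<open>For non-basic \<open>X\<close> this unfolds the clause, as \<open>bot_i\<close> fails in
  every consistent system.\<close>

lemma holds_Clas_iff: "holds S (Clas X) \<longleftrightarrow> (\<exists>S'. S' \<sqsupseteq> S \<and> holds S' (Intu X))"
proof (cases "is_Basic X")
  case False
  then show ?thesis by (auto simp: extends_def consistent_def)
next
  case True
  then obtain p where X: "X = Basic p" by (cases X) auto
  have "\<not> derives S {p} Falsum \<longleftrightarrow> (\<exists>S'. S' \<sqsupseteq> S \<and> derives S' {} p)"
  proof
    assume "\<not> derives S {p} Falsum"
    then have "insert (Rule [] p) S \<sqsupseteq> S"
      using derives_insert_axiom[of p S "{}"] by (auto simp: extends_def consistent_def)
    moreover have "derives (insert (Rule [] p) S) {} p"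
      by (rule derives.rule[of "[]"]) auto
    ultimately show "\<exists>S'. S' \<sqsupseteq> S \<and> derives S' {} p" by blast
  next
    assume "\<exists>S'. S' \<sqsupseteq> S \<and> derives S' {} p"
    then obtain S' where S': "consistent S'" "S \<subseteq> S'" "derives S' {} p"
      by (auto simp: extends_def)
    show "\<not> derives S {p} Falsum"
    proof
      assume "derives S {p} Falsum"
      then have "derives S' {p} Falsum" using S'(2) by (rule derives_mono) simp
      \<comment> \<open>The assumption \<open>p\<close> is replaced by its closed derivation in
        \<open>S'\<close>.\<close>
      then have "derives S' {} Falsum" by (rule derives_cut) (use S'(3) in auto)
      then show False using S'(1) by (simp add: consistent_def)
    qed
  qed
  then show ?thesis by (simp add: X)
qed

text \<open>No consistent system validates \<open>bot_i\<close>, so the implication holds only if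
  its premise never holds throughout the extensions of any \<open>S'\<close>.\<close>

lemma holds_Neg_iff:
  "holds S (Neg A) \<longleftrightarrow> \<not> (\<exists>S'. S' \<sqsupseteq> S \<and> (\<forall>S''. S'' \<sqsupseteq> S' \<longrightarrow> holds S'' A))"
proof -
  have "\<not> derives S'' {} Falsum" if "S'' \<sqsupseteq> S'" for S' S'' :: "'a system"
    using that by (simp add: extends_def consistent_def)
  moreover have "S' \<sqsupseteq> S'" if "S' \<sqsupseteq> S" for S'
    using that by (simp add: extends_def)
  ultimately show ?thesis unfolding Neg_def holds.simps by blast
qed

text \<open>Unfolding both negations gives two successive extensions of \<open>S'\<close>;
  transitivity merges them into the single \<open>T\<close>.\<close>

lemma holds_Neg_Neg_iff:
  "holds S (Neg (Neg A)) \<longleftrightarrow>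
     (\<forall>S'. S' \<sqsupseteq> S \<longrightarrow> (\<exists>T. T \<sqsupseteq> S' \<and> (\<forall>T'. T' \<sqsupseteq> T \<longrightarrow> holds T' A)))"
proof -
  have "S' \<sqsupseteq> S'" if "S' \<sqsupseteq> S" for S'
    using that by (simp add: extends_def)
  then show ?thesis
    unfolding holds_Neg_iff[of S "Neg A"] holds_Neg_iff[of _ A] by (blast intro: extends_trans)
qed

theorem theorem5:
  fixes X :: "'a::{countable, infinite} shape"
  shows "{Clas X} \<tturnstile> Neg (Neg (Intu X)) \<and> {Neg (Neg (Intu X))} \<tturnstile> Clas X"
proof
  have "holds S'' (Neg (Neg (Intu X)))"
    if clas: "\<And>T. T \<sqsupseteq> S' \<Longrightarrow> holds T (Clas X)" and "S'' \<sqsupseteq> S'" for S' S''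
    unfolding holds_Neg_Neg_iff
  proof (intro allI impI)
    fix T
    assume "T \<sqsupseteq> S''"
    then have "consistent T" by (simp add: extends_def)
    then obtain M where M: "M \<sqsupseteq> T" "\<And>T'. T' \<sqsupseteq> M \<Longrightarrow> T' = M"
      by (rule maximal_extension_exists) blast
    have "M \<sqsupseteq> S'" using M(1) \<open>T \<sqsupseteq> S''\<close> \<open>S'' \<sqsupseteq> S'\<close> extends_trans by blast
    \<comment> \<open>The extension of \<open>M\<close> supplied by \<open>Clas X\<close> can only
      be \<open>M\<close> itself.\<close>
    then have "holds M (Intu X)" using clas[of M] M(2) by (auto simp: holds_Clas_iff)
    then show "\<exists>M. M \<sqsupseteq> T \<and> (\<forall>T'. T' \<sqsupseteq> M \<longrightarrow> holds T' (Intu X))"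
      using M by blast
  qed
  then show "{Clas X} \<tturnstile> Neg (Neg (Intu X))"
    by (auto simp: conseq_def global_conseq_def)
next
  have "holds S (Clas X)" if dneg: "holds S (Neg (Neg (Intu X)))" and con: "consistent S" for S
  proof -
    \<comment> \<open>The double negation is used at \<open>S\<close> itself; \<open>T\<close>, as
      an extension of itself, then witnesses \<open>Clas X\<close>.\<close>
    obtain T where "T \<sqsupseteq> S" "\<And>T'. T' \<sqsupseteq> T \<Longrightarrow> holds T' (Intu X)"
      using dneg extends_refl[OF con] unfolding holds_Neg_Neg_iff by blast
    moreover from this have "T \<sqsupseteq> T" by (simp add: extends_def)
    ultimately show ?thesis using holds_Clas_iff by blast
  qed
  then show "{Neg (Neg (Intu X))} \<tturnstile> Clas X"
    by (auto simp: conseq_def global_conseq_def extends_def)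
qed

end
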